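(* There are absolute constants $c_1,c_2,c_3,c_4>0$ such that for arbitrarily large $n$ there exist a finite set $A \subseteq \mathbb{Q}_{>0}$ with $c_1 n \leq |A| \leq c_2 n$ and a bipartite graph $G$ with both vertex classes equal to (copies of) $A$ and edge set $E(G) \subseteq A \times A$ with $|E(G)| \geq c_3 n^{3/2}$, such that $$|A +_G A| + |A /_G A| + |(A+1) /_G (A+1)| + |A -_G A| \leq c_4\, n.$$
   Context: For a finite set $A \subseteq \mathbb{R}$ and edge set $E(G) \subseteq A \times A$, define $A+_G A := \{a+b : (a,b)\in E(G)\}$, $A-_G A := \{a-b : (a,b)\in E(G)\}$, and, whenever the denominators are nonzero, $(A+x)/_G(A+y) := \{\frac{a+x}{b+y} : (a,b) \in E(G)\}$ for $x,y\in\mathbb{R}$; in particular $A/_G A = \{a/b : (a,b) \in E(G)\}$. *)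

theory Defs
  imports Complex_Main
begin

text \<open>
  A bipartite graph \<open>G\<close> whose two vertex classes are copies of a set \<open>A\<close> is represented by its
  edge set, a relation \<open>E \<subseteq> A \<times> A\<close>; the pair \<open>(a, b)\<close> is the edge from \<open>a\<close> in the first copy to
  \<open>b\<close> in the second copy, so that loops \<open>(a, a)\<close> and asymmetric relations are allowed.
\<close>

definition sum_along :: "(real \<times> real) set \<Rightarrow> real set" where
  "sum_along E = {a + b | a b. (a, b) \<in> E}"

definition diff_along :: "(real \<times> real) set \<Rightarrow> real set" where
  "diff_along E = {a - b | a b. (a, b) \<in> E}"

text \<open>
  The set \<open>(A + x) /\<^sub>G (A + y)\<close>. The side condition keeps the convention \<open>z / 0 = 0\<close> from
  contributing spurious elements.
\<close>

definition quot_along :: "real \<Rightarrow> real \<Rightarrow> (real \<times> real) set \<Rightarrow> real set" where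
  "quot_along x y E = {(a + x) / (b + y) | a b. (a, b) \<in> E \<and> b + y \<noteq> 0}"

end

theory Submission
  imports Defs
begin

text \<open>
  Let \<open>A\<close> consist of the fractions \<open>x/z\<close> with \<open>1 \<le> x, z \<le> m\<close>, and join \<open>x/z\<close> to \<open>y/z\<close>. For such
  an edge the sum \<open>(x + y)/z\<close>, the difference \<open>(x - y)/z\<close>, the ratio \<open>x/y\<close> and the shifted ratio
  \<open>(x + z)/(y + z)\<close> each have numerator and denominator of size \<open>O(m)\<close>, so every one of them takes
  only \<open>O(m\<^sup>2)\<close> values. A positive proportion of the pairs \<open>(x, z)\<close> is coprime, and the edges
  arising from coprime \<open>(x, z)\<close> and arbitrary \<open>y\<close> are pairwise distinct. Hence with \<open>n = m\<^sup>2\<close>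
  there are at least a constant times \<open>n\<close> vertices and \<open>n powr (3/2)\<close> edges.
\<close>

section \<open>Counting coprime pairs in a square\<close>

text \<open>Telescoping via \<open>1/d^2 \<le> 1/(d-1) - 1/d\<close>, but with the term
  \<open>d = 2\<close> kept exact as 1/4 = 3/4 - 1/2. Telescoping that term too would give the limit
  1; a limit below 1 is what leaves a positive proportion of coprime pairs.\<close>

lemma sum_inverse_squares_le:
  "(\<Sum>d = 2..Suc (Suc k). 1 / real d ^ 2) \<le> 3 / 4 - 1 / real (Suc (Suc k))"
proof (induction k)
  case 0
  then show ?case by (simp add: numeral_2_eq_2)
next
  case (Suc k)
  have "1 / real (Suc (Suc (Suc k))) ^ 2 \<le> 1 / real (Suc (Suc k)) - 1 / real (Suc (Suc (Suc k)))"
    by (simp add: divide_simps power2_eq_square)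
  with Suc.IH show ?case by simp
qed

text \<open>Dividing both entries by their gcd \<open>d \<ge> 2\<close> lands in the box of side
  \<open>m div d\<close>. The covering sets may overlap, which is harmless for an upper
  bound.\<close>

lemma noncoprime_pairs_subset:
  fixes m :: nat
  shows "{(x, z) \<in> {1..m} \<times> {1..m}. \<not> coprime x z}
     \<subseteq> (\<Union>d\<in>{2..m}. (\<lambda>(a, b). (d * a, d * b)) ` ({1..m div d} \<times> {1..m div d}))"
proof (clarify)
  fix x z :: nat
  assume x: "x \<in> {1..m}" and z: "z \<in> {1..m}" and nc: "\<not> coprime x z"
  define d where "d = gcd x z"
  obtain a b where ab: "x = d * a" "z = d * b"
    by (metis d_def dvdE gcd_dvd1 gcd_dvd2)
  have "d \<noteq> 0" "d \<noteq> 1" using x nc by (auto simp: d_def coprime_iff_gcd_eq_1)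
  moreover have "d \<le> m"
    using x unfolding d_def by (intro order_trans[OF gcd_le1_nat]) simp_all
  ultimately have "d \<in> {2..m}" by simp
  moreover have "a \<in> {1..m div d}"
  proof -
    have "0 < d * a" "d * a \<le> m" using x ab by auto
    then show ?thesis
      using \<open>d \<noteq> 0\<close> by (simp add: less_eq_div_iff_mult_less_eq mult.commute Suc_le_eq)
  qed
  moreover have "b \<in> {1..m div d}"
  proof -
    have "0 < d * b" "d * b \<le> m" using z ab by auto
    then show ?thesis
      using \<open>d \<noteq> 0\<close> by (simp add: less_eq_div_iff_mult_less_eq mult.commute Suc_le_eq)
  qed
  ultimately show "(x, z) \<in> (\<Union>d\<in>{2..m}. (\<lambda>(a, b). (d * a, d * b)) ` ({1..m div d} \<times> {1..m div d}))"
    by (intro UN_I[of d] image_eqI[of _ _ "(a, b)"]) (simp_all add: ab)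
qed

text \<open>Union bound over the common divisor \<open>d\<close>: each contributes at most
  \<open>(m/d)^2\<close> non-coprime pairs, together at most 3/4 of all \<open>m^2\<close>
  pairs.\<close>

lemma card_coprime_pairs_ge:
  assumes "m \<ge> 2"
  shows "real m ^ 2 / 4 \<le> real (card {(x, z) \<in> {1..m} \<times> {1..m}. coprime x z})"
proof -
  let ?P = "{1..m} \<times> {1..m}"
  let ?C = "{(x, z) \<in> ?P. coprime x z}" and ?N = "{(x, z) \<in> ?P. \<not> coprime x z}"
  let ?T = "\<lambda>d. (\<lambda>(a, b). (d * a, d * b)) ` ({1..m div d} \<times> {1..m div d})"
  have fin: "finite ?C" "finite ?N"
    by (rule finite_subset[of _ ?P]; auto)+
  have "?P = ?C \<union> ?N" "?C \<inter> ?N = {}" by auto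
  then have "card ?C + card ?N = card ?P"
    using card_Un_disjoint[OF fin] by presburger
  then have split: "card ?C + card ?N = m * m" by simp
  have "card ?N \<le> card (\<Union>d\<in>{2..m}. ?T d)"
    by (rule card_mono[OF _ noncoprime_pairs_subset]) auto
  also have "\<dots> \<le> (\<Sum>d = 2..m. card (?T d))" by (rule card_UN_le) simp
  also have "\<dots> \<le> (\<Sum>d = 2..m. (m div d) ^ 2)"
  proof (rule sum_mono)
    fix d
    show "card (?T d) \<le> (m div d) ^ 2"
      using card_image_le[of "{1..m div d} \<times> {1..m div d}" "\<lambda>(a, b). (d * a, d * b)"]
      by (simp add: power2_eq_square)
  qed
  finally have "real (card ?N) \<le> real (\<Sum>d = 2..m. (m div d) ^ 2)"
    by (simp only: of_nat_le_iff)
  also have "\<dots> = (\<Sum>d = 2..m. real (m div d) ^ 2)" by simp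
  also have "\<dots> \<le> (\<Sum>d = 2..m. (real m / real d) ^ 2)"
    by (intro sum_mono power_mono of_nat_div_le_of_nat) simp
  also have "\<dots> = real m ^ 2 * (\<Sum>d = 2..m. 1 / real d ^ 2)"
    by (simp add: sum_distrib_left power_divide)
  also have "\<dots> \<le> real m ^ 2 * (3 / 4)"
  proof (rule mult_left_mono)
    obtain k where "m = Suc (Suc k)" using assms by (metis add_2_eq_Suc le_Suc_ex)
    then have "(\<Sum>d = 2..m. 1 / real d ^ 2) \<le> 3 / 4 - 1 / real m"
      by (simp only: sum_inverse_squares_le)
    also have "\<dots> \<le> 3 / 4" by simp
    finally show "(\<Sum>d = 2..m. 1 / real d ^ 2) \<le> 3 / 4" .
  qed simp
  finally have "real (card ?N) \<le> real m ^ 2 * (3 / 4)" .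
  moreover have "real (card ?C) + real (card ?N) = real m ^ 2"
    using split by (simp add: power2_eq_square flip: of_nat_add of_nat_mult)
  ultimately show ?thesis by simp
qed

section \<open>The graph: vertices, edges and lower bounds on their number\<close>

definition fractions :: "nat \<Rightarrow> real set" where
  "fractions m = (\<lambda>(x, z). real x / real z) ` ({1..m} \<times> {1..m})"

text \<open>The indices are grouped as \<open>((x, z), y)\<close> so that restricting
  \<open>(x, z)\<close> to coprime pairs, with \<open>y\<close> free, still leaves a product set to
  count.\<close>

definition fraction_edges :: "nat \<Rightarrow> (real \<times> real) set" where
  "fraction_edges m =
     (\<lambda>((x, z), y). (real x / real z, real y / real z)) ` (({1..m} \<times> {1..m}) \<times> {1..m})"

lemma finite_fractions: "finite (fractions m)"
  by (simp add: fractions_def)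

lemma fractions_subset: "fractions m \<subseteq> \<rat> \<inter> {0<..}"
  by (auto simp: fractions_def)

lemma fraction_edges_subset: "fraction_edges m \<subseteq> fractions m \<times> fractions m"
  by (force simp: fraction_edges_def fractions_def)

lemma fraction_edgesE:
  assumes "(a, b) \<in> fraction_edges m"
  obtains x y z where "x \<in> {1..m}" "y \<in> {1..m}" "z \<in> {1..m}"
    "a = real x / real z" "b = real y / real z"
  using assms by (auto simp: fraction_edges_def)

lemma inj_on_coprime_fraction:
  "inj_on (\<lambda>(x, z). real x / real z) {(x, z) \<in> {1..m} \<times> {1..m}. coprime x z}"
proof (rule inj_onI, clarify)
  fix x z x' z' :: nat
  assume z: "z \<in> {1..m}" "z' \<in> {1..m}" and c: "coprime x z" "coprime x' z'"
    and eq: "real x / real z = real x' / real z'"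
  from eq z have "real (x * z') = real (x' * z)" by (simp add: field_simps)
  then have "x * z' = x' * z" by (simp only: of_nat_eq_iff)
  with c show "x = x' \<and> z = z'"
    by (simp add: coprime_crossproduct_nat)
qed

text \<open>The first endpoint, being in lowest terms, reveals \<open>x\<close> and the common
  denominator \<open>z\<close>; the second endpoint then yields \<open>y\<close>, which need not be
  coprime to \<open>z\<close>.\<close>

lemma inj_on_coprime_edge:
  "inj_on (\<lambda>((x, z), y). (real x / real z, real y / real z))
     ({(x, z) \<in> {1..m} \<times> {1..m}. coprime x z} \<times> {1..m})"
proof (rule inj_onI, clarify)
  fix x z y x' z' y' :: nat
  assume P: "x \<in> {1..m}" "z \<in> {1..m}" "x' \<in> {1..m}" "z' \<in> {1..m}"
    and c: "coprime x z" "coprime x' z'"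
    and eq: "real x / real z = real x' / real z'" "real y / real z = real y' / real z'"
  have "(x, z) = (x', z')"
    by (rule inj_onD[OF inj_on_coprime_fraction[of m]]) (use P c eq(1) in auto)
  with eq(2) P show "(x, z) = (x', z') \<and> y = y'" by auto
qed

lemma card_fractions_le: "card (fractions m) \<le> m ^ 2"
  using card_image_le[of "{1..m} \<times> {1..m}" "\<lambda>(x, z). real x / real z"]
  by (simp add: fractions_def power2_eq_square)

lemma card_fractions_ge:
  assumes "m \<ge> 2"
  shows "real m ^ 2 / 4 \<le> real (card (fractions m))"
proof -
  let ?C = "{(x, z) \<in> {1..m} \<times> {1..m}. coprime x z}"
  have "card ?C = card ((\<lambda>(x, z). real x / real z) ` ?C)"
    by (rule card_image[OF inj_on_coprime_fraction, symmetric])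
  also have "\<dots> \<le> card (fractions m)"
    by (rule card_mono[OF finite_fractions]) (auto simp: fractions_def)
  finally show ?thesis using card_coprime_pairs_ge[OF assms] by linarith
qed

lemma card_fraction_edges_ge:
  assumes "m \<ge> 2"
  shows "real m ^ 3 / 4 \<le> real (card (fraction_edges m))"
proof -
  let ?C = "{(x, z) \<in> {1..m} \<times> {1..m}. coprime x z}"
  let ?f = "\<lambda>((x, z), y). (real x / real z, real y / real z)"
  have "real m ^ 3 / 4 = real m ^ 2 / 4 * real m"
    by (simp add: power2_eq_square power3_eq_cube)
  also have "\<dots> \<le> real (card ?C) * real m"
    by (rule mult_right_mono[OF card_coprime_pairs_ge[OF assms]]) simp
  also have "\<dots> = real (card (?C \<times> {1..m}))" by (simp add: card_cartesian_product)
  also have "\<dots> = real (card (?f ` (?C \<times> {1..m})))"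
    by (simp only: card_image[OF inj_on_coprime_edge])
  also have "\<dots> \<le> real (card (fraction_edges m))"
    unfolding of_nat_le_iff fraction_edges_def by (intro card_mono image_mono) auto
  finally show ?thesis .
qed

section \<open>Upper bounds for the sum, difference and ratio sets\<close>

lemma card_le_of_subset_image:
  assumes "S \<subseteq> f ` B" "finite B"
  shows "card S \<le> card B"
  using assms by (meson card_image_le card_mono finite_imageI order_trans)

lemma card_sum_along_fraction_edges: "card (sum_along (fraction_edges m)) \<le> 2 * m ^ 2"
proof -
  have "sum_along (fraction_edges m) \<subseteq> (\<lambda>(s, z). real s / real z) ` ({1..2 * m} \<times> {1..m})"
  proof
    fix t assume "t \<in> sum_along (fraction_edges m)"
    then obtain x y z where "x \<in> {1..m}" "y \<in> {1..m}" "z \<in> {1..m}"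
      "t = real x / real z + real y / real z"
      unfolding sum_along_def by (blast elim: fraction_edgesE)
    then show "t \<in> (\<lambda>(s, z). real s / real z) ` ({1..2 * m} \<times> {1..m})"
      by (intro image_eqI[of _ _ "(x + y, z)"]) (auto simp: add_divide_distrib)
  qed
  from card_le_of_subset_image[OF this] show ?thesis by (simp add: power2_eq_square)
qed

lemma card_diff_along_fraction_edges: "card (diff_along (fraction_edges m)) \<le> 3 * m ^ 2"
proof -
  have "diff_along (fraction_edges m)
    \<subseteq> (\<lambda>(s, z). real_of_int s / real z) ` ({- int m..int m} \<times> {1..m})"
  proof
    fix t assume "t \<in> diff_along (fraction_edges m)"
    then obtain x y z where "x \<in> {1..m}" "y \<in> {1..m}" "z \<in> {1..m}"
      "t = real x / real z - real y / real z"
      unfolding diff_along_def by (blast elim: fraction_edgesE)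
    then show "t \<in> (\<lambda>(s, z). real_of_int s / real z) ` ({- int m..int m} \<times> {1..m})"
      \<comment> \<open>The numerator may be zero or negative, hence integers: subtraction on
        \<open>nat\<close> would truncate.\<close>
      by (intro image_eqI[of _ _ "(int x - int y, z)"]) (auto simp: diff_divide_distrib)
  qed
  from card_le_of_subset_image[OF this]
  have "card (diff_along (fraction_edges m)) \<le> nat (2 * int m + 1) * m" by simp
  also have "nat (2 * int m + 1) = 2 * m + 1" by simp
  \<comment> \<open>The extra \<open>m\<close>, from the numerator 0, is absorbed by
    \<open>m \<le> m^2\<close>.\<close>
  also have "(2 * m + 1) * m \<le> 3 * m ^ 2" by (simp add: power2_eq_square)
  finally show ?thesis .
qed

lemma card_quot_along_fraction_edges: "card (quot_along 0 0 (fraction_edges m)) \<le> m ^ 2"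
proof -
  have "quot_along 0 0 (fraction_edges m) \<subseteq> (\<lambda>(x, y). real x / real y) ` ({1..m} \<times> {1..m})"
  proof
    fix t assume "t \<in> quot_along 0 0 (fraction_edges m)"
    then obtain x y z where "x \<in> {1..m}" "y \<in> {1..m}" "z \<in> {1..m}"
      "t = (real x / real z + 0) / (real y / real z + 0)"
      unfolding quot_along_def by (blast elim: fraction_edgesE)
    then show "t \<in> (\<lambda>(x, y). real x / real y) ` ({1..m} \<times> {1..m})"
      by (intro image_eqI[of _ _ "(x, y)"]) auto
  qed
  from card_le_of_subset_image[OF this] show ?thesis by (simp add: power2_eq_square)
qed

lemma card_shifted_quot_along_fraction_edges:
  "card (quot_along 1 1 (fraction_edges m)) \<le> 4 * m ^ 2"
proof -
  have "quot_along 1 1 (fraction_edges m)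
    \<subseteq> (\<lambda>(x, y). real x / real y) ` ({1..2 * m} \<times> {1..2 * m})"
  proof
    fix t assume "t \<in> quot_along 1 1 (fraction_edges m)"
    then obtain x y z where xyz: "x \<in> {1..m}" "y \<in> {1..m}" "z \<in> {1..m}"
      and t: "t = (real x / real z + 1) / (real y / real z + 1)"
      unfolding quot_along_def by (blast elim: fraction_edgesE)
    \<comment> \<open>Since 1 = \<open>z/z\<close>, the shift keeps the denominator
      \<open>z\<close>, which then cancels in the ratio.\<close>
    have "real x / real z + 1 = real (x + z) / real z"
      "real y / real z + 1 = real (y + z) / real z"
      using xyz by (simp_all add: add_divide_distrib)
    with t xyz have "t = real (x + z) / real (y + z)" by simp
    with xyz show "t \<in> (\<lambda>(x, y). real x / real y) ` ({1..2 * m} \<times> {1..2 * m})"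
      by (intro image_eqI[of _ _ "(x + z, y + z)"]) auto
  qed
  from card_le_of_subset_image[OF this] show ?thesis by (simp add: power2_eq_square)
qed

theorem theorem9:
  "\<exists>c1 c2 c3 c4 :: real. c1 > 0 \<and> c2 > 0 \<and> c3 > 0 \<and> c4 > 0 \<and>
     (\<forall>N :: nat. \<exists>n \<ge> N. \<exists>(A :: real set) (E :: (real \<times> real) set).
        finite A \<and> A \<subseteq> \<rat> \<inter> {0<..} \<and>
        c1 * real n \<le> real (card A) \<and> real (card A) \<le> c2 * real n \<and>
        E \<subseteq> A \<times> A \<and>
        real (card E) \<ge> c3 * real n powr (3/2) \<and>
        real (card (sum_along E) + card (quot_along 0 0 E)
              + card (quot_along 1 1 E) + card (diff_along E)) \<le> c4 * real n)"
\<comment> \<open>Both constants 1/4 come from the density of coprime pairs; 10 = 2 + 1 + 4 + 3 adds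
  the bounds for sums, ratios, shifted ratios and differences.\<close>
proof (rule exI[of _ "1/4"], rule exI[of _ 1], rule exI[of _ "1/4"], rule exI[of _ 10],
    intro conjI allI)
  fix N :: nat
  \<comment> \<open>This gives both \<open>m \<ge> 2\<close>, as the lower bounds require, and
    \<open>m^2 \<ge> N\<close>.\<close>
  define m where "m = N + 2"
  define n where "n = m ^ 2"
  let ?A = "fractions m" and ?E = "fraction_edges m"
  have m: "m \<ge> 2" by (simp add: m_def)
  have "N \<le> n" by (simp add: n_def m_def power2_eq_square)
  moreover have "1/4 * real n \<le> real (card ?A)"
    using card_fractions_ge[OF m] by (simp add: n_def)
  moreover have "real (card ?A) \<le> 1 * real n"
    using card_fractions_le[of m] by (simp add: n_def del: of_nat_power)
  moreover have "real (card ?E) \<ge> 1/4 * real n powr (3/2)"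
  proof -
    \<comment> \<open>As \<open>n = m^2\<close>, the target \<open>n powr (3/2)\<close> is exactly
      the \<open>m^3\<close> of the edge count.\<close>
    have "real n powr (3/2) = (real m powr 2) powr (3/2)"
      using m by (simp add: n_def)
    also have "\<dots> = real m powr 3" by (simp only: powr_powr) simp
    also have "\<dots> = real m ^ 3" using m by simp
    finally show ?thesis using card_fraction_edges_ge[OF m] by simp
  qed
  moreover have "real (card (sum_along ?E) + card (quot_along 0 0 ?E)
      + card (quot_along 1 1 ?E) + card (diff_along ?E)) \<le> 10 * real n"
  proof -
    have "card (sum_along ?E) + card (quot_along 0 0 ?E)
      + card (quot_along 1 1 ?E) + card (diff_along ?E) \<le> 10 * n"
      using card_sum_along_fraction_edges[of m] card_quot_along_fraction_edges[of m]
        card_shifted_quot_along_fraction_edges[of m] card_diff_along_fraction_edges[of m]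
      by (simp add: n_def)
    then have "real (card (sum_along ?E) + card (quot_along 0 0 ?E)
      + card (quot_along 1 1 ?E) + card (diff_along ?E)) \<le> real (10 * n)"
      by (simp only: of_nat_le_iff)
    then show ?thesis by simp
  qed
  ultimately show "\<exists>n \<ge> N. \<exists>(A :: real set) (E :: (real \<times> real) set).
        finite A \<and> A \<subseteq> \<rat> \<inter> {0<..} \<and>
        1/4 * real n \<le> real (card A) \<and> real (card A) \<le> 1 * real n \<and>
        E \<subseteq> A \<times> A \<and>
        real (card E) \<ge> 1/4 * real n powr (3/2) \<and>
        real (card (sum_along E) + card (quot_along 0 0 E)
              + card (quot_along 1 1 E) + card (diff_along E)) \<le> 10 * real n"
    using finite_fractions fractions_subset fraction_edges_subset
    by (intro exI[of _ n] exI[of _ ?A] exI[of _ ?E] conjI)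
qed simp_all

end
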